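(* For monotone covering with discrete variable domains (each variable $x_j$ restricted to a countable set $U_j\subset\mathbb R_+$ such that every $x_j\in U_j$ that is not maximal in $U_j$ has a smallest element of $U_j$ above it), there is a stateless randomized online algorithm that is a $\Delta$-approximation: it maintains a single current solution $x$ with $x_j\in U_j$ for all $j$, only increases coordinates, satisfies each revealed constraint before the next is revealed, and its final expected cost is at most $\Delta$ times the minimum cost of a solution $x^*$ with $x^*_j\in U_j$ for all $j$ satisfying all constraints.
   Context: A monotone covering instance consists of a collection $\mathcal C$ of monotone (closed upwards componentwise) subsets of $\mathbb R_+^n$ and a non-decreasing submodular cost $c:\mathbb R_+^n\to\mathbb R_+$ (i.e. $c(x)+c(y)\ge c(x\wedge y)+c(x\vee y)$, componentwise min/max). $\mathrm{vars}(S)$ is the set of coordinates constraint $S$ depends on and $\Delta=\max_{S}|\mathrm{vars}(S)|$. In the online setting, constraints are revealed one at a time and the algorithm, without knowledge of future constraints, must increase coordinates of its current solution so that it satisfies the revealed constraint. A stateless online algorithm keeps no information other than its current solution, each of whose variables stays in its domain $U_j$ at all times.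
   Formalization: Each U_j is additionally assumed nonempty and well-ordered (every nonempty subset has a least element), since the claim fails for any domain with an infinite descending sequence; constraint sequences are finite, nonempty and feasible, with Δ ≥ 1. *)

theory Defs
  imports "HOL-Analysis.Analysis" "HOL-Probability.Probability_Mass_Function"
begin

text \<open>The order, \<^term>\<open>inf\<close> and \<^term>\<open>sup\<close> on \<^typ>\<open>real ^ 'n\<close> are the componentwise ones, so
  \<^term>\<open>{0..} :: (real ^ 'n) set\<close> is the nonnegative orthant. Cost functions are total functions
  of which only the values on the orthant matter.\<close>

definition covering_cost :: "(real ^ 'n \<Rightarrow> real) \<Rightarrow> bool" where
  "covering_cost c \<longleftrightarrow>
     (\<forall>x\<in>{0..}. 0 \<le> c x) \<and>
     mono_on {0..} c \<and>
     (\<forall>x\<in>{0..}. \<forall>y\<in>{0..}. c (inf x y) + c (sup x y) \<le> c x + c y)"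

definition covering_constraint :: "(real ^ 'n) set \<Rightarrow> bool" where
  "covering_constraint S \<longleftrightarrow> S \<subseteq> {0..} \<and> (\<forall>x\<in>S. \<forall>y. x \<le> y \<longrightarrow> y \<in> S)"

definition vars :: "(real ^ 'n) set \<Rightarrow> 'n set" where
  "vars S = {j. \<exists>x\<in>{0..}. \<exists>y\<in>{0..}. (\<forall>i. i \<noteq> j \<longrightarrow> x $ i = y $ i) \<and> x \<in> S \<and> y \<notin> S}"

definition Delta :: "(real ^ 'n) set set \<Rightarrow> nat" where
  "Delta \<C> = Max ((\<lambda>S. card (vars S)) ` \<C>)"

definition discrete_domain :: "real set \<Rightarrow> bool" where
  "discrete_domain V \<longleftrightarrow>
     V \<noteq> {} \<and> V \<subseteq> {0..} \<and> countable V \<and>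
     (\<forall>u\<in>V. (\<exists>v\<in>V. u < v) \<longrightarrow> (\<exists>v\<in>V. u < v \<and> (\<forall>w\<in>V. u < w \<longrightarrow> v \<le> w)))"

text \<open>No infinite descent inside a domain. Discreteness in the sense above does not give this:
  \<open>V = {1 - 1/n | n \<ge> 1} \<union> {1 + 1/n | n \<ge> 1}\<close> is a \<^const>\<open>discrete_domain\<close>. In one variable with
  \<open>c x = x\<close>, whatever an algorithm does on the constraint \<open>x > 1\<close>, its expected cost exceeds
  \<open>1 + 1/m\<close> for some \<open>m\<close>, and so exceeds the optimum once \<open>x \<ge> 1 + 1/m\<close> is revealed next, while
  \<open>\<Delta> = 1\<close>. The same argument applies to every domain with an infinite descending sequence,
  including those without a least element. Closed discrete domains satisfy the condition.\<close>

definition well_ordered_domain :: "real set \<Rightarrow> bool" where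
  "well_ordered_domain V \<longleftrightarrow> (\<forall>T\<subseteq>V. T \<noteq> {} \<longrightarrow> (\<exists>m\<in>T. \<forall>t\<in>T. m \<le> t))"

definition domain_points :: "('n \<Rightarrow> real set) \<Rightarrow> (real ^ 'n) set" where
  "domain_points U = {x. \<forall>j. x $ j \<in> U j}"

definition solutions :: "('n \<Rightarrow> real set) \<Rightarrow> (real ^ 'n) set set \<Rightarrow> (real ^ 'n) set" where
  "solutions U \<C> = {x \<in> domain_points U. \<forall>S\<in>\<C>. x \<in> S}"

text \<open>Only used when \<^term>\<open>solutions U \<C>\<close> is nonempty; costs are nonnegative there, so the infimum
  is genuine, and it is the minimum whenever a minimum exists.\<close>

definition opt_cost ::
  "('n \<Rightarrow> real set) \<Rightarrow> (real ^ 'n \<Rightarrow> real) \<Rightarrow> (real ^ 'n) set set \<Rightarrow> real" where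
  "opt_cost U c \<C> = Inf (c ` solutions U \<C>)"

text \<open>A stateless randomized algorithm maps the revealed constraint and the current solution, and
  nothing else, to the distribution of the next solution. Probability mass functions lose no
  generality, since there are only countably many domain points.\<close>

type_synonym 'n stateless_alg = "(real ^ 'n) set \<Rightarrow> real ^ 'n \<Rightarrow> (real ^ 'n) pmf"

definition stateless_online_alg :: "('n::finite \<Rightarrow> real set) \<Rightarrow> 'n stateless_alg \<Rightarrow> bool" where
  "stateless_online_alg U A \<longleftrightarrow>
     (\<forall>S. \<forall>x\<in>domain_points U. covering_constraint S \<longrightarrow>
        (\<forall>y\<in>set_pmf (A S x).
           y \<in> domain_points U \<and> x \<le> y \<and> (solutions U {S} \<noteq> {} \<longrightarrow> y \<in> S)))"

primrec run :: "'n::finite stateless_alg \<Rightarrow> (real ^ 'n) set list \<Rightarrow> real ^ 'n \<Rightarrow> (real ^ 'n) pmf" where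
  "run A [] x = return_pmf x"
| "run A (S # Ss) x = bind_pmf (A S x) (run A Ss)"

text \<open>The initial solution and the algorithm are fixed before the constraints. The requirement
  \<open>1 \<le> \<Delta>\<close> only excludes sequences all of whose constraints hold everywhere on the orthant:
  there the bound would be \<open>0\<close>, although every solution may have positive cost.\<close>

definition Delta_approximation ::
  "('n::finite \<Rightarrow> real set) \<Rightarrow> (real ^ 'n \<Rightarrow> real) \<Rightarrow> real ^ 'n \<Rightarrow> 'n stateless_alg \<Rightarrow> bool" where
  "Delta_approximation U c x0 A \<longleftrightarrow>
     (\<forall>Ss. Ss \<noteq> [] \<longrightarrow> (\<forall>S\<in>set Ss. covering_constraint S) \<longrightarrow> solutions U (set Ss) \<noteq> {} \<longrightarrow>
        1 \<le> Delta (set Ss) \<longrightarrow>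
        integrable (measure_pmf (run A Ss x0)) c \<and>
        measure_pmf.expectation (run A Ss x0) c \<le> real (Delta (set Ss)) * opt_cost U c (set Ss))"

end

theory Submission
  imports Defs
begin

text \<open>
  By Dickson's lemma for products of well-orders, the domain points of a constraint \<open>S\<close> all lie above
  one of finitely many points \<open>M \<subseteq> S\<close>. While \<open>x \<notin> S\<close>, pick a random coordinate \<open>j \<in> vars S\<close> that is below
  some coordinate of \<open>M\<close>, with probability inversely proportional to the cost \<open>w j\<close> of raising \<open>x $ j\<close>
  to the next larger coordinate of \<open>M\<close>, and raise it. Using the finite grid spanned by \<open>M\<close> instead of
  successors in \<open>U j\<close> makes this stop, even if \<open>U j\<close> has accumulation points.

  For a solution \<open>z\<close> consider \<open>\<phi> x = c (sup x z) - c x\<close>. By submodularity no step increases \<open>\<phi>\<close>, and a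
  step that does not exceed \<open>sup x z\<close> decreases it by its full cost; such a step is always available.
  As all products of probability and cost are the same number \<open>b\<close>, the expected cost of a step is at
  most \<open>\<Delta> b\<close>, and \<open>\<phi>\<close> decreases by at least \<open>b\<close> in expectation. So the expected value of
  \<open>c x + \<Delta> \<phi> x\<close> never increases.
\<close>

section \<open>Finite bases in products of well-ordered sets\<close>

lemma sup_vec_nth: "sup x y $ i = max (x $ i) (y $ i)" for x y :: "real ^ 'n"
  by (simp add: sup_vec_def sup_max)

text \<open>Dickson's lemma, by induction on \<open>J\<close>. A finite set that is a basis for the coordinates \<open>J\<close> fails
  for \<open>insert j J\<close> only at points whose \<open>j\<close>-th coordinate is below the maximum \<open>B\<close> over that set; these
  are handled by well-founded induction on \<open>B\<close>.\<close>

lemma finite_basis_coords: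
  fixes U :: "'n::finite \<Rightarrow> real set" and J :: "'n set"
  assumes "finite J" and wo: "\<And>j. well_ordered_domain (U j)"
    and "T \<subseteq> domain_points U"
  shows "\<exists>M. finite M \<and> M \<subseteq> T \<and> (\<forall>z\<in>T. \<exists>m\<in>M. \<forall>j\<in>J. m $ j \<le> z $ j)"
  using assms(1,3)
proof (induction J arbitrary: T)
  case empty
  show ?case
  proof (cases "T = {}")
    case False
    then obtain t where "t \<in> T" by blast
    then show ?thesis by (intro exI[of _ "{t}"]) auto
  qed auto
next
  case (insert j J)
  define basis where
    "basis M T \<longleftrightarrow> finite M \<and> M \<subseteq> T \<and> (\<forall>z\<in>T. \<exists>m\<in>M. \<forall>i\<in>insert j J. m $ i \<le> z $ i)"
    for M T :: "(real ^ 'n) set"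
  have extend: "\<exists>M. basis M T'"
    if T': "T' \<subseteq> T" and below: "\<And>v. v \<in> (\<lambda>z. z $ j) ` T' \<Longrightarrow> \<exists>M. basis M {z \<in> T'. z $ j < v}" for T'
  proof (cases "T' = {}")
    case True
    then show ?thesis by (auto simp: basis_def)
  next
    case False
    from insert.IH[OF order_trans[OF T' insert.prems]] obtain M0 where M0: "finite M0" "M0 \<subseteq> T'"
      "\<And>z. z \<in> T' \<Longrightarrow> \<exists>m\<in>M0. \<forall>i\<in>J. m $ i \<le> z $ i" by blast
    with False have "M0 \<noteq> {}" by blast
    define B where "B = Max ((\<lambda>z. z $ j) ` M0)"
    have "B \<in> (\<lambda>z. z $ j) ` M0"
      unfolding B_def using M0(1) \<open>M0 \<noteq> {}\<close> by (intro Max_in) auto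
    with M0(2) have "B \<in> (\<lambda>z. z $ j) ` T'" by blast
    from below[OF this] obtain M1 where M1: "basis M1 {z \<in> T'. z $ j < B}" by blast
    have "\<exists>m\<in>M0 \<union> M1. \<forall>i\<in>insert j J. m $ i \<le> z $ i" if z: "z \<in> T'" for z
    proof (cases "z $ j < B")
      case True
      then show ?thesis using M1 z unfolding basis_def by blast
    next
      \<comment> \<open>A point of \<open>M0\<close> that is below \<open>z\<close> on
        \<open>J\<close> is also below it at \<open>j\<close>, as
        \<open>m $ j \<le> B \<le> z $ j\<close>.\<close>
      case False
      obtain m where m: "m \<in> M0" "\<forall>i\<in>J. m $ i \<le> z $ i" using M0(3)[OF z] by blast
      have "m $ j \<le> B" unfolding B_def using m(1) M0(1) by (intro Max_ge) auto
      with False m show ?thesis by (intro bexI[of _ m]) auto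
    qed
    then have "basis (M0 \<union> M1) T'" using M0 M1 unfolding basis_def by auto
    then show ?thesis by blast
  qed
  have low: "\<exists>M. basis M {z \<in> T. z $ j < v}" if "v \<in> U j" for v
  proof (rule ccontr)
    assume bad: "\<not> ?thesis"
    \<comment> \<open>Minimal counterexample: all domain values below the least bad threshold
      \<open>w\<close> are good, so \<open>extend\<close> makes \<open>w\<close> good as
      well.\<close>
    define Bad where "Bad = {v \<in> U j. \<not> (\<exists>M. basis M {z \<in> T. z $ j < v})}"
    have "Bad \<noteq> {}" "Bad \<subseteq> U j" using bad that by (auto simp: Bad_def)
    then obtain w where w: "w \<in> Bad" "\<forall>t\<in>Bad. w \<le> t"
      using wo[of j] unfolding well_ordered_domain_def by meson
    have "\<exists>M. basis M {z \<in> T. z $ j < w}"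
    proof (rule extend)
      fix u assume u: "u \<in> (\<lambda>z. z $ j) ` {z \<in> T. z $ j < w}"
      then have "u < w" "u \<in> U j" using insert.prems by (auto simp: domain_points_def)
      then have "\<exists>M. basis M {z \<in> T. z $ j < u}" using w(2) by (force simp: Bad_def)
      moreover have "{z \<in> {z \<in> T. z $ j < w}. z $ j < u} = {z \<in> T. z $ j < u}"
        using \<open>u < w\<close> by auto
      ultimately show "\<exists>M. basis M {z \<in> {z \<in> T. z $ j < w}. z $ j < u}" by simp
    qed auto
    with w(1) show False by (simp add: Bad_def)
  qed
  have "\<exists>M. basis M T"
  proof (rule extend)
    fix v assume "v \<in> (\<lambda>z. z $ j) ` T"
    then have "v \<in> U j" using insert.prems by (auto simp: domain_points_def)
    then show "\<exists>M. basis M {z \<in> T. z $ j < v}" by (rule low)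
  qed simp
  then show ?case by (simp add: basis_def)
qed

lemma finite_basis:
  fixes U :: "'n::finite \<Rightarrow> real set"
  assumes "\<And>j. well_ordered_domain (U j)" and "T \<subseteq> domain_points U"
  shows "\<exists>M. finite M \<and> M \<subseteq> T \<and> (\<forall>z\<in>T. \<exists>m\<in>M. m \<le> z)"
  using finite_basis_coords[where J = UNIV, OF finite assms] by (simp add: less_eq_vec_def)

section \<open>Consequences of monotonicity and submodularity\<close>

text \<open>The point \<open>sup x m\<close> lies in \<open>S\<close> by upward closure. Resetting
  its coordinates outside \<open>vars S\<close> to those of \<open>x\<close>, one at a time, never
  leaves \<open>S\<close>, and the result is \<open>x\<close>.\<close>

lemma mem_constraint_if_ge_on_vars:
  fixes S :: "(real ^ 'n) set"
  assumes S: "covering_constraint S" and m: "m \<in> S" and x: "0 \<le> x"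
    and ge: "\<And>j. j \<in> vars S \<Longrightarrow> m $ j \<le> x $ j"
  shows "x \<in> S"
proof -
  define y where "y B = (\<chi> i. if i \<in> B then x $ i else max (x $ i) (m $ i))" for B
  have y0: "0 \<le> y B" for B
    using x by (auto simp: y_def less_eq_vec_def le_max_iff_disj)
  have "finite B \<Longrightarrow> B \<inter> vars S = {} \<Longrightarrow> y B \<in> S" for B
  proof (induction B rule: finite_induct)
    case empty
    have "m \<le> y {}" by (simp add: y_def less_eq_vec_def)
    then show ?case using S m unfolding covering_constraint_def by blast
  next
    case (insert j B)
    then have "y B \<in> S" "j \<notin> vars S" by auto
    moreover have "\<forall>i. i \<noteq> j \<longrightarrow> y B $ i = y (insert j B) $ i" by (simp add: y_def)
    ultimately show ?case
      using y0[of B] y0[of "insert j B"] unfolding vars_def by auto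
  qed
  from this[of "- vars S"] have "y (- vars S) \<in> S" by simp
  moreover have "y (- vars S) = x" using ge by (auto simp: y_def vec_eq_iff)
  ultimately show ?thesis by simp
qed

text \<open>Submodularity is applied to \<open>y\<close> and \<open>sup x z\<close>: their join is
  \<open>sup y z\<close>, and their meet lies above \<open>x\<close>, so it costs at least
  \<open>c x\<close>.\<close>

lemma covering_cost_sup_diff_le:
  assumes c: "covering_cost c" and "0 \<le> x" "x \<le> y" "0 \<le> z"
  shows "c (sup y z) - c (sup x z) \<le> c y - c x"
proof -
  define w where "w = sup x z"
  have w: "0 \<le> w" "x \<le> w" using assms by (auto simp: w_def intro: le_supI1)
  have y: "0 \<le> y" using assms(2,3) by (rule order_trans)
  have "sup y w = sup y z"
    unfolding w_def using assms(3) by (metis sup.absorb1 sup_assoc)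
  moreover have "c (inf y w) + c (sup y w) \<le> c y + c w"
    using c w y unfolding covering_cost_def by auto
  moreover have "c x \<le> c (inf y w)"
    using c assms w y unfolding covering_cost_def
    by (auto intro!: mono_onD[of "{0..}" c])
  ultimately show ?thesis by (simp add: w_def)
qed

section \<open>One random step\<close>

text \<open>For positive weights, probabilities proportional to \<open>1 / w j\<close> work; every
  product is then the reciprocal of the normalising sum \<open>Z\<close>.\<close>

lemma pmf_equalizing_costs:
  fixes w :: "'a \<Rightarrow> real"
  assumes J: "finite J" "J \<noteq> {}" and w: "\<And>j. j \<in> J \<Longrightarrow> 0 \<le> w j"
  obtains q b where "set_pmf q \<subseteq> J" "\<And>j. j \<in> J \<Longrightarrow> pmf q j * w j = b"
proof (cases "\<exists>i\<in>J. w i = 0")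
  case True
  then obtain i where "i \<in> J" "w i = 0" by blast
  \<comment> \<open>A free choice is made with certainty, so that all products vanish.\<close>
  then show ?thesis using that[of "return_pmf i" 0] by (auto simp: indicator_def)
next
  case False
  with w have pos: "\<And>j. j \<in> J \<Longrightarrow> 0 < w j" by force
  define Z where "Z = (\<Sum>j\<in>J. 1 / w j)"
  have Z: "0 < Z" unfolding Z_def using J pos by (intro sum_pos) auto
  define f where "f j = (if j \<in> J then 1 / (w j * Z) else 0)" for j
  have f0: "0 \<le> f j" for j using pos Z by (auto simp: f_def less_imp_le)
  have "(\<integral>\<^sup>+ j. ennreal (f j) \<partial>count_space UNIV) = (\<integral>\<^sup>+ j. ennreal (f j) \<partial>count_space J)"
    by (rule nn_integral_count_space_eq) (auto simp: f_def)
  also have "\<dots> = ennreal (\<Sum>j\<in>J. f j)"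
    using J f0 by (simp add: nn_integral_count_space_finite sum_ennreal)
  also have "(\<Sum>j\<in>J. f j) = (\<Sum>j\<in>J. 1 / w j) / Z"
    unfolding sum_divide_distrib by (rule sum.cong) (auto simp: f_def)
  also have "\<dots> = 1" using Z by (simp add: Z_def)
  finally have f1: "(\<integral>\<^sup>+ j. ennreal (f j) \<partial>count_space UNIV) = 1" by simp
  show ?thesis
  proof (rule that[of "embed_pmf f" "1 / Z"])
    show "set_pmf (embed_pmf f) \<subseteq> J"
      by (auto simp: set_embed_pmf[OF f0 f1] f_def split: if_splits)
    show "pmf (embed_pmf f) j * w j = 1 / Z" if "j \<in> J" for j
      using that pos[of j] by (simp add: pmf_embed_pmf[OF f0 f1] f_def)
  qed
qed

text \<open>For \<open>x\<close> and \<open>z\<close> in the orthant and \<open>K \<ge> 0\<close>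
  this is an upper bound on \<open>c x\<close>. At a start in the orthant below \<open>z\<close>,
  with \<open>K \<ge> 1\<close>, it is at most \<open>K * c z\<close>.\<close>

definition potential :: "(real ^ 'n \<Rightarrow> real) \<Rightarrow> real \<Rightarrow> real ^ 'n \<Rightarrow> real ^ 'n \<Rightarrow> real" where
  "potential c K z x = c x + K * (c (sup x z) - c x)"

text \<open>The choice of \<open>q\<close> depends only on \<open>x\<close> and the targets
  \<open>r j\<close>, so it serves all \<open>z\<close> and \<open>K\<close> at once. With
  \<open>b\<close> the common product, \<open>c x\<close> grows by \<open>card J * b\<close> in
  expectation, but \<open>c (sup x z)\<close> by at most \<open>(card J - 1) * b\<close>, since some
  target leaves it unchanged. Hence the drift is at most
  \<open>(card J - K) * b \<le> 0\<close>.\<close>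

lemma exists_random_step:
  fixes c :: "real ^ 'n \<Rightarrow> real" and J :: "'n set"
  assumes c: "covering_cost c" and x: "0 \<le> x" and J: "J \<noteq> {}"
    and ge: "\<And>j. j \<in> J \<Longrightarrow> x \<le> r j"
  obtains q where "set_pmf q \<subseteq> J"
    "\<And>z K. 0 \<le> z \<Longrightarrow> real (card J) \<le> K \<Longrightarrow> \<exists>j\<in>J. r j \<le> sup x z \<Longrightarrow>
       (\<Sum>j\<in>J. pmf q j * potential c K z (r j)) \<le> potential c K z x"
proof -
  have mono: "c x \<le> c y" if "x \<le> y" for y
    using c x that order_trans[OF x that] unfolding covering_cost_def by (auto dest: mono_onD)
  obtain q b where q: "set_pmf q \<subseteq> J" and b: "\<And>j. j \<in> J \<Longrightarrow> pmf q j * (c (r j) - c x) = b"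
    using pmf_equalizing_costs[of J "\<lambda>j. c (r j) - c x"] J mono ge by auto
  have q1: "(\<Sum>j\<in>J. pmf q j) = 1" using q by (simp add: sum_pmf_eq_1)
  show ?thesis
  proof (rule that[OF q])
    fix z K assume z: "0 \<le> z" and K: "real (card J) \<le> K" and "\<exists>j\<in>J. r j \<le> sup x z"
    then obtain j0 where j0: "j0 \<in> J" "r j0 \<le> sup x z" by blast
    have b0: "0 \<le> b" unfolding b[OF j0(1), symmetric] using mono[OF ge[OF j0(1)]] by simp
    have K0: "0 \<le> K" using K by (meson of_nat_0_le_iff order_trans)
    \<comment> \<open>\<open>d j\<close> is the growth of \<open>c (sup x z)\<close> in the move to
      \<open>r j\<close>; it is at most the cost of that move, and zero for
      \<open>j0\<close>.\<close>
    define d where "d j = c (sup (r j) z) - c (sup x z)" for j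
    have d: "pmf q j * d j \<le> b" if "j \<in> J" for j
      using mult_left_mono[OF covering_cost_sup_diff_le[OF c x ge[OF that] z], of "pmf q j"] b[OF that]
      by (simp add: d_def)
    have "sup (r j0) z = sup x z"
      using j0(2) ge[OF j0(1)] by (intro antisym) (auto intro: le_supI1)
    then have d0: "d j0 = 0" by (simp add: d_def)
    have "(\<Sum>j\<in>J. pmf q j * d j) = (\<Sum>j\<in>J - {j0}. pmf q j * d j)"
      using j0(1) d0 by (simp add: sum.remove)
    also have "\<dots> \<le> (\<Sum>j\<in>J - {j0}. b)" using d by (intro sum_mono) auto
    also have "\<dots> = (real (card J) - 1) * b"
      using card.remove[OF finite j0(1)] by simp
    finally have sum_d: "(\<Sum>j\<in>J. pmf q j * d j) \<le> (real (card J) - 1) * b" .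
    have "(\<Sum>j\<in>J. pmf q j * potential c K z (r j)) - potential c K z x
        = (\<Sum>j\<in>J. pmf q j * (potential c K z (r j) - potential c K z x))"
      using q1 by (simp add: right_diff_distrib sum_subtractf flip: sum_distrib_right)
    also have "\<dots> = (\<Sum>j\<in>J. b + K * (pmf q j * d j - b))"
    \<comment> \<open>With \<open>a = c (r j) - c x\<close>, the move to \<open>r j\<close> changes
      the potential by \<open>a + K * (d j - a)\<close>, and \<open>pmf q j * a = b\<close>.\<close>
    proof (rule sum.cong)
      fix j assume "j \<in> J"
      show "pmf q j * (potential c K z (r j) - potential c K z x)
          = b + K * (pmf q j * d j - b)"
        unfolding b[OF \<open>j \<in> J\<close>, symmetric] by (simp add: potential_def d_def algebra_simps)
    qed simp
    also have "\<dots> = real (card J) * b + K * ((\<Sum>j\<in>J. pmf q j * d j) - real (card J) * b)"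
      by (simp add: sum.distrib sum_subtractf flip: sum_distrib_left)
    also have "\<dots> \<le> real (card J) * b + K * ((real (card J) - 1) * b - real (card J) * b)"
      using sum_d K0 by (intro add_left_mono mult_left_mono) auto
    also have "\<dots> = (real (card J) - K) * b" by (simp add: algebra_simps)
    also have "\<dots> \<le> 0" using K b0 by (simp add: mult_nonpos_nonneg)
    finally show "(\<Sum>j\<in>J. pmf q j * potential c K z (r j)) \<le> potential c K z x" by simp
  qed
qed

section \<open>The response to one constraint\<close>

text \<open>The bound covers all \<open>z\<close> and \<open>K\<close> simultaneously, because the
  response is chosen without knowing the optimum or the final \<open>Delta\<close>. Finite support
  turns expectations into finite sums and gives integrability.\<close>

definition good_response ::
  "('n::finite \<Rightarrow> real set) \<Rightarrow> (real ^ 'n \<Rightarrow> real) \<Rightarrow> (real ^ 'n) set \<Rightarrow> real ^ 'n \<Rightarrow> (real ^ 'n) pmf \<Rightarrow> bool"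
  where
  "good_response U c S x p \<longleftrightarrow>
     finite (set_pmf p) \<and> set_pmf p \<subseteq> domain_points U \<inter> S \<inter> {x..} \<and>
     (\<forall>z\<in>domain_points U \<inter> S. \<forall>K \<ge> real (card (vars S)).
        measure_pmf.expectation p (potential c K z) \<le> potential c K z x)"

text \<open>Induction on the number of pairs \<open>(j, m)\<close> with \<open>m \<in> M\<close> and
  \<open>x $ j < m $ j\<close>: each raise removes a pair and adds none. The first random raise is
  composed by \<open>bind_pmf\<close> with responses at the raised points.\<close>

lemma exists_good_response:
  fixes U :: "'n::finite \<Rightarrow> real set"
  assumes c: "covering_cost c" and nonneg: "\<And>j. U j \<subseteq> {0..}"
    and wo: "\<And>j. well_ordered_domain (U j)" and S: "covering_constraint S"
    and feasible: "domain_points U \<inter> S \<noteq> {}" and x: "x \<in> domain_points U"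
  shows "\<exists>p. good_response U c S x p"
proof -
  obtain M where M: "finite M" "M \<subseteq> domain_points U \<inter> S"
    "\<And>z. z \<in> domain_points U \<inter> S \<Longrightarrow> \<exists>m\<in>M. m \<le> z"
    using finite_basis[OF wo Int_lower1[of "domain_points U" S]] by blast
  have dom0: "0 \<le> y" if "y \<in> domain_points U" for y
    using that nonneg by (fastforce simp: domain_points_def less_eq_vec_def)
  define higher where "higher y = {(j, m) \<in> UNIV \<times> M. y $ j < m $ j}" for y :: "real ^ 'n"
  have fin_higher: "finite (higher y)" for y
    unfolding higher_def using M(1) by (auto intro: finite_subset[of _ "UNIV \<times> M"])
  show ?thesis using x
  proof (induction "card (higher x)" arbitrary: x rule: less_induct)
    case less
    show ?case
    proof (cases "x \<in> S")
      case True
      then show ?thesis using less.prems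
        by (intro exI[of _ "return_pmf x"]) (simp add: good_response_def)
    next
      case False
      define J where "J = {j \<in> vars S. \<exists>m\<in>M. x $ j < m $ j}"
      \<comment> \<open>The next coordinate of the grid above \<open>x $ j\<close>. For
        \<open>j \<in> J\<close> the set is nonempty, and its members lie in \<open>U j\<close>
        because \<open>M\<close> consists of domain points.\<close>
      define v where "v j = Min {m $ j | m. m \<in> M \<and> x $ j < m $ j}" for j
      define r where "r j = (\<chi> i. if i = j then v j else x $ i)" for j
      have v_in: "\<exists>m\<in>M. v j = m $ j \<and> x $ j < m $ j" if "j \<in> J" for j
      proof -
        have "v j \<in> {m $ j | m. m \<in> M \<and> x $ j < m $ j}"
          unfolding v_def using that M(1) by (intro Min_in) (auto simp: J_def)
        then show ?thesis by blast
      qed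
      have v_le: "v j \<le> m $ j" if "m \<in> M" "x $ j < m $ j" for j m
        unfolding v_def using that M(1) by (intro Min_le) auto
      have r_dom: "r j \<in> domain_points U" if "j \<in> J" for j
        using v_in[OF that] M(2) less.prems by (auto simp: r_def domain_points_def)
      have r_ge: "x \<le> r j" if "j \<in> J" for j
        using v_in[OF that] by (auto simp: r_def less_eq_vec_def)
      have r_higher: "card (higher (r j)) < card (higher x)" if j: "j \<in> J" for j
      proof (rule psubset_card_mono[OF fin_higher])
        obtain m where m: "m \<in> M" "v j = m $ j" "x $ j < m $ j" using v_in[OF j] by blast
        have "higher (r j) \<subseteq> higher x"
          using r_ge[OF j] unfolding higher_def less_eq_vec_def by (auto intro: le_less_trans)
        moreover have "(j, m) \<in> higher x" "(j, m) \<notin> higher (r j)"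
          using m by (auto simp: higher_def r_def)
        ultimately show "higher (r j) \<subset> higher x" by blast
      qed
      \<comment> \<open>As \<open>x \<notin> S\<close>, a basis point \<open>m \<le> z\<close>
        exceeds \<open>x\<close> at some \<open>j \<in> vars S\<close>. The raise there stops at
        \<open>v j \<le> m $ j \<le> z $ j\<close>.\<close>
      have useful: "\<exists>j\<in>J. r j \<le> sup x z" if "z \<in> domain_points U \<inter> S" for z
      proof -
        obtain m where m: "m \<in> M" "m \<le> z" using M(3)[OF \<open>z \<in> domain_points U \<inter> S\<close>] by blast
        obtain j where j: "j \<in> vars S" "x $ j < m $ j"
          using mem_constraint_if_ge_on_vars[OF S _ dom0[OF less.prems], of m] m(1) M(2) False
          by force
        have "v j \<le> z $ j" 
          using v_le[OF m(1) j(2)] m(2) unfolding less_eq_vec_def by (blast intro: order_trans)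
        then have "r j \<le> sup x z" by (simp add: r_def less_eq_vec_def sup_vec_nth)
        with j m(1) show ?thesis by (auto simp: J_def)
      qed
      then have "J \<noteq> {}" using feasible by blast
      obtain q where q: "set_pmf q \<subseteq> J"
        "\<And>z K. 0 \<le> z \<Longrightarrow> real (card J) \<le> K \<Longrightarrow> \<exists>j\<in>J. r j \<le> sup x z \<Longrightarrow>
           (\<Sum>j\<in>J. pmf q j * potential c K z (r j)) \<le> potential c K z x"
        using exists_random_step[OF c dom0[OF less.prems] \<open>J \<noteq> {}\<close>, of r] r_ge by blast
      have "\<forall>j\<in>J. \<exists>p. good_response U c S (r j) p"
        using less.hyps r_higher r_dom by blast
      then obtain p where p: "\<And>j. j \<in> J \<Longrightarrow> good_response U c S (r j) (p j)" by metis
      have "card J \<le> card (vars S)" by (rule card_mono) (auto simp: J_def)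
      have "good_response U c S x (bind_pmf q p)"
        unfolding good_response_def
      proof (intro conjI ballI allI impI)
        show "finite (set_pmf (bind_pmf q p))"
          using q(1) p by (auto simp: good_response_def)
        show "set_pmf (bind_pmf q p) \<subseteq> domain_points U \<inter> S \<inter> {x..}"
        proof
          fix y assume "y \<in> set_pmf (bind_pmf q p)"
          then obtain j where j: "j \<in> J" "y \<in> set_pmf (p j)" using q(1) by auto
          then have "y \<in> domain_points U \<inter> S \<inter> {r j..}"
            using p[OF j(1)] unfolding good_response_def by blast
          then show "y \<in> domain_points U \<inter> S \<inter> {x..}"
            using order_trans[OF r_ge[OF j(1)]] by simp
        qed
        fix z K assume z: "z \<in> domain_points U \<inter> S" and K: "real (card (vars S)) \<le> K"
        have "measure_pmf.expectation (bind_pmf q p) (potential c K z)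
            = (\<Sum>j\<in>J. pmf q j * measure_pmf.expectation (p j) (potential c K z))"
          using q(1) p by (subst pmf_expectation_bind[of J]) (auto simp: good_response_def)
        also have "\<dots> \<le> (\<Sum>j\<in>J. pmf q j * potential c K z (r j))"
          using p z K by (intro sum_mono mult_left_mono) (auto simp: good_response_def)
        also have "\<dots> \<le> potential c K z x"
          using q(2)[OF dom0 _ useful[OF z]] z K \<open>card J \<le> card (vars S)\<close> by force
        finally show "measure_pmf.expectation (bind_pmf q p) (potential c K z) \<le> potential c K z x" .
      qed
      then show ?thesis by blast
    qed
  qed
qed

section \<open>Whole runs and the approximation ratio\<close>

text \<open>A solution \<open>z\<close> of the whole list satisfies each single constraint, and
  \<open>K\<close> dominates each \<open>card (vars S)\<close>, so the bounds for the individual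
  responses chain with \<open>z\<close> and \<open>K\<close> fixed.\<close>

lemma run_potential_le:
  fixes U :: "'n::finite \<Rightarrow> real set"
  assumes A: "\<And>S x. covering_constraint S \<Longrightarrow> domain_points U \<inter> S \<noteq> {} \<Longrightarrow> x \<in> domain_points U \<Longrightarrow>
      good_response U c S x (A S x)"
    and "\<forall>S\<in>set Ss. covering_constraint S" and "z \<in> solutions U (set Ss)"
    and "\<forall>S\<in>set Ss. real (card (vars S)) \<le> K" and "x \<in> domain_points U"
  shows "finite (set_pmf (run A Ss x)) \<and> set_pmf (run A Ss x) \<subseteq> domain_points U \<and>
    measure_pmf.expectation (run A Ss x) (potential c K z) \<le> potential c K z x"
  using assms(2-)
proof (induction Ss arbitrary: x)
  case Nil
  then show ?case by simp
next
  case (Cons S Ss)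
  have z: "z \<in> domain_points U \<inter> S" "z \<in> solutions U (set Ss)"
    using Cons.prems(2) by (auto simp: solutions_def)
  then have resp: "good_response U c S x (A S x)" using A Cons.prems by auto
  let ?P = "set_pmf (A S x)"
  have fin: "finite ?P" and dom: "?P \<subseteq> domain_points U"
    using resp by (auto simp: good_response_def)
  have IH: "finite (set_pmf (run A Ss y)) \<and> set_pmf (run A Ss y) \<subseteq> domain_points U \<and>
    measure_pmf.expectation (run A Ss y) (potential c K z) \<le> potential c K z y" if "y \<in> ?P" for y
    using Cons.IH[of y] Cons.prems z(2) dom that by auto
  have "measure_pmf.expectation (run A (S # Ss) x) (potential c K z)
      = (\<Sum>y\<in>?P. pmf (A S x) y * measure_pmf.expectation (run A Ss y) (potential c K z))"
    using IH fin by (simp, subst pmf_expectation_bind[of ?P]) auto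
  also have "\<dots> \<le> (\<Sum>y\<in>?P. pmf (A S x) y * potential c K z y)"
    using IH by (intro sum_mono mult_left_mono) auto
  also have "\<dots> = measure_pmf.expectation (A S x) (potential c K z)"
    using fin by (subst integral_measure_pmf[of ?P]) (auto simp: mult.commute)
  also have "\<dots> \<le> potential c K z x"
    using resp z(1) Cons.prems(3) by (auto simp: good_response_def)
  finally show ?case using IH fin by auto
qed

theorem theorem7:
  fixes c :: "real ^ 'n \<Rightarrow> real" and U :: "'n \<Rightarrow> real set"
  assumes "covering_cost c"
    and "\<And>j. discrete_domain (U j)"
    and "\<And>j. well_ordered_domain (U j)"
  shows "\<exists>x0 A. x0 \<in> domain_points U \<and> stateless_online_alg U A \<and> Delta_approximation U c x0 A"
proof -
  have nonneg: "\<And>j. U j \<subseteq> {0..}" and nonempty: "\<And>j. U j \<noteq> {}"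
    using assms(2) by (auto simp: discrete_domain_def)
  have dom0: "0 \<le> y" if "y \<in> domain_points U" for y
    using that nonneg by (fastforce simp: domain_points_def less_eq_vec_def)
  have "\<forall>j. \<exists>m\<in>U j. \<forall>t\<in>U j. m \<le> t"
    using assms(3) nonempty unfolding well_ordered_domain_def by (meson order_refl)
  then obtain l where l: "\<And>j. l j \<in> U j" "\<And>j t. t \<in> U j \<Longrightarrow> l j \<le> t" by metis
  \<comment> \<open>The least domain point lies below every solution \<open>z\<close>, so
    \<open>sup x0 z = z\<close> in the initial potential.\<close>
  define x0 :: "real ^ 'n" where "x0 = (\<chi> j. l j)"
  have x0: "x0 \<in> domain_points U" "\<And>y. y \<in> domain_points U \<Longrightarrow> x0 \<le> y"
    using l by (auto simp: x0_def domain_points_def less_eq_vec_def)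
  \<comment> \<open>The chosen distribution depends on \<open>S\<close> and \<open>x\<close> alone.
    A constraint without domain points leaves \<open>x\<close> unchanged.\<close>
  define A :: "'n stateless_alg" where
    "A S x = (if domain_points U \<inter> S = {} then return_pmf x else SOME p. good_response U c S x p)"
    for S x
  have A: "good_response U c S x (A S x)"
    if "covering_constraint S" "domain_points U \<inter> S \<noteq> {}" "x \<in> domain_points U" for S x
    using someI_ex[OF exists_good_response[OF assms(1) nonneg assms(3) that]] that(2) by (simp add: A_def)
  have "stateless_online_alg U A"
    unfolding stateless_online_alg_def
  proof (intro allI ballI impI)
    fix S x y assume H: "x \<in> domain_points U" "covering_constraint S" "y \<in> set_pmf (A S x)"
    show "y \<in> domain_points U \<and> x \<le> y \<and> (solutions U {S} \<noteq> {} \<longrightarrow> y \<in> S)"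
    proof (cases "domain_points U \<inter> S = {}")
      case True
      then show ?thesis using H by (auto simp: A_def solutions_def)
    next
      case False
      then show ?thesis using A[OF H(2) False H(1)] H(3) by (auto simp: good_response_def)
    qed
  qed
  moreover have "Delta_approximation U c x0 A"
    unfolding Delta_approximation_def
  proof (intro allI impI)
    fix Ss assume H: "Ss \<noteq> []" "\<forall>S\<in>set Ss. covering_constraint S" "solutions U (set Ss) \<noteq> {}"
      "1 \<le> Delta (set Ss)"
    define K where "K = real (Delta (set Ss))"
    let ?R = "run A Ss x0"
    have K: "1 \<le> K" using H(4) by (simp add: K_def)
    have vars_le: "\<forall>S\<in>set Ss. real (card (vars S)) \<le> K" by (simp add: K_def Delta_def)
    have pot: "finite (set_pmf ?R) \<and> set_pmf ?R \<subseteq> domain_points U \<and>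
        measure_pmf.expectation ?R (potential c K z) \<le> potential c K z x0"
      if "z \<in> solutions U (set Ss)" for z
      by (rule run_potential_le[OF _ H(2) that vars_le x0(1)]) (rule A)
    have fin: "finite (set_pmf ?R)" using pot H(3) by blast
    \<comment> \<open>\<open>opt_cost\<close> is an infimum, so the bound is shown against every
      solution and divided by \<open>K\<close> to give a lower bound on all their costs.\<close>
    have bound: "measure_pmf.expectation ?R c / K \<le> c z" if z: "z \<in> solutions U (set Ss)" for z
    proof -
      have zd: "z \<in> domain_points U" using z by (simp add: solutions_def)
      have "c y \<le> potential c K z y" if "y \<in> set_pmf ?R" for y
      proof -
        have "0 \<le> y" using pot[OF z] that dom0[of y] by auto
        moreover from this have "0 \<le> sup y z" by (rule le_supI1)
        ultimately have "c y \<le> c (sup y z)"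
          using assms(1) unfolding covering_cost_def by (auto dest: mono_onD)
        then show ?thesis using K by (simp add: potential_def)
      qed
      then have "measure_pmf.expectation ?R c \<le> measure_pmf.expectation ?R (potential c K z)"
        using fin by (intro integral_mono_AE integrable_measure_pmf_finite)
          (auto simp: AE_measure_pmf_iff)
      also have "\<dots> \<le> potential c K z x0" using pot[OF z] by blast
      also have "\<dots> = K * c z - (K - 1) * c x0"
        using x0(2)[OF zd] by (simp add: potential_def sup.absorb2 algebra_simps)
      \<comment> \<open>By \<open>1 \<le> Delta (set Ss)\<close> the dropped term
        \<open>(K - 1) * c x0\<close> is nonnegative.\<close>
      also have "\<dots> \<le> K * c z"
        using K assms(1) dom0[OF x0(1)] by (simp add: covering_cost_def)
      finally show ?thesis using K by (simp add: divide_le_eq mult.commute)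
    qed
    have "measure_pmf.expectation ?R c / K \<le> opt_cost U c (set Ss)"
      unfolding opt_cost_def using H(3) bound by (intro cInf_greatest) auto
    then show "integrable (measure_pmf ?R) c \<and>
        measure_pmf.expectation ?R c \<le> real (Delta (set Ss)) * opt_cost U c (set Ss)"
      using K fin by (simp add: integrable_measure_pmf_finite divide_le_eq mult.commute flip: K_def)
  qed
  ultimately show ?thesis using x0(1) by blast
qed

end
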